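(* Let $X\neq\{0\}$ be a complex Banach space, let $\mathcal{U}=\{U(n,m): n\ge m\ge 0\}\subset\mathcal{L}(X)$ be an exponentially bounded discrete evolution family, and let $\mathcal{X}$ be one of the sequence spaces $c_0^0(\mathbb{Z}_+,X)$, $l_0^\infty(\mathbb{Z}_+,X)$, or $l_0^p(\mathbb{Z}_+,X)$ with $1\le p<\infty$. Let $\mathcal{T}_{\mathcal{X}}=\{\mathcal{T}_{\mathcal{X}}(j)\}_{j\in\mathbb{Z}_+}$ be the evolution semigroup associated to $\mathcal{U}$ on $\mathcal{X}$, and let $\mathcal{K}_{\mathcal{X}}$ be the convolution operator $\mathcal{K}_{\mathcal{X}}f=U\ast f$ with domain $D(\mathcal{K}_{\mathcal{X}})=\{f\in\mathcal{X}: U\ast f\in\mathcal{X}\}$. The following statements are equivalent. 1. The family $\mathcal{U}$ is uniformly exponentially stable, i.e. its uniform growth bound satisfies $\omega_0(\mathcal{U})<0$. 2. The evolution semigroup $\mathcal{T}_{\mathcal{X}}$ is uniformly exponentially stable, i.e. the spectral radius satisfies $r(\mathcal{T}_{\mathcal{X}}(1))<1$. 3. For each $f\in\mathcal{X}$, $U\ast f$ belongs to $\mathcal{X}$. 4. The linear operator $f\mapsto\mathcal{K}_{\mathcal{X}}f$ is a bounded operator on $\mathcal{X}$, i.e. $D(\mathcal{K}_{\mathcal{X}})=\mathcal{X}$ and there is a constant $c$ with $\|U\ast f\|_{\mathcal{X}}\le c\|f\|_{\mathcal{X}}$ for all $f\in\mathcal{X}$.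
   Context: $\mathbb{Z}_+=\{0,1,2,\dots\}$; $\mathcal{L}(X)$ is the Banach algebra of bounded linear operators on $X$. Sequence spaces: $l_0^\infty(\mathbb{Z}_+,X)$ is the space of bounded $X$-valued sequences $(f_n)_{n\in\mathbb{Z}_+}$ with $f_0=0$, with the sup norm; $c_0^0(\mathbb{Z}_+,X)$ is its closed subspace of sequences with $\lim_{n\to\infty}f_n=0$ (and $f_0=0$), with the sup norm; for $1\le p<\infty$, $l_0^p(\mathbb{Z}_+,X)$ is the space of $X$-valued sequences with $f_0=0$ and $\|f\|_p=(\sum_{k=0}^\infty\|f_k\|^p)^{1/p}<\infty$, with norm $\|\cdot\|_p$. A discrete evolution family is a family $\mathcal{U}=\{U(n,m): n,m\in\mathbb{Z}_+, n\ge m\}\subset\mathcal{L}(X)$ with $U(m,m)=I$ and $U(m,n)=U(m,p)U(p,n)$ for all $m\ge p\ge n$ in $\mathbb{Z}_+$. Let $\Omega(\mathcal{U})$ be the set of real $\omega$ with $\sup_{n\ge m\ge 0}e^{-\omega(n-m)}\|U(n,m)\|<\infty$. The family is exponentially bounded if $\Omega(\mathcal{U})\ne\emptyset$, and its uniform growth bound is $\omega_0(\mathcal{U})=\inf\Omega(\mathcal{U})\in[-\infty,\infty)$. The evolution semigroup on $\mathcal{X}$ is given, for $j\in\mathbb{Z}_+$ and $f=(f_n)\in\mathcal{X}$, by $(\mathcal{T}_{\mathcal{X}}(j)f)(k)=U(k,k-j)f_{k-j}$ if $k\ge j$, and $(\mathcal{T}_{\mathcal{X}}(j)f)(k)=0$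 if $k<j$; each $\mathcal{T}_{\mathcal{X}}(j)$ is a bounded linear operator on $\mathcal{X}$ and $\mathcal{T}_{\mathcal{X}}(j)=\mathcal{T}_{\mathcal{X}}(1)^j$. The convolution is $(U\ast f)(k)=\sum_{j=0}^k U(k,j)f_j$ for $f=(f_n)\in\mathcal{X}$, $k\in\mathbb{Z}_+$. *)

theory Defs
  imports "HOL-Analysis.Analysis"
begin

text \<open>The distribution only provides real Banach spaces; a complex one is a real Banach space
  with a compatible complex scalar multiplication.\<close>

class scaleC =
  fixes scaleC :: "complex \<Rightarrow> 'a \<Rightarrow> 'a" (infixr "*\<^sub>C" 75)

class complex_normed_vector = real_normed_vector + scaleC +
  assumes scaleC_add_right: "a *\<^sub>C (x + y) = a *\<^sub>C x + a *\<^sub>C y"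
    and scaleC_add_left: "(a + b) *\<^sub>C x = a *\<^sub>C x + b *\<^sub>C x"
    and scaleC_scaleC: "a *\<^sub>C (b *\<^sub>C x) = (a * b) *\<^sub>C x"
    and scaleC_one: "1 *\<^sub>C x = x"
    and scaleC_of_real: "Complex r 0 *\<^sub>C x = r *\<^sub>R x"
    and norm_scaleC: "norm (a *\<^sub>C x) = cmod a * norm x"

class complex_banach = complex_normed_vector + banach


section \<open>Sequence spaces\<close>

definition linf0 :: "(nat \<Rightarrow> 'a::real_normed_vector) set" where
  "linf0 = {f. f 0 = 0 \<and> bounded (range f)}"

definition c00 :: "(nat \<Rightarrow> 'a::real_normed_vector) set" where
  "c00 = {f \<in> linf0. f \<longlonglongrightarrow> 0}"

definition lp0 :: "real \<Rightarrow> (nat \<Rightarrow> 'a::real_normed_vector) set" where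
  "lp0 p = {f. f 0 = 0 \<and> summable (\<lambda>k. norm (f k) powr p)}"

definition sup_norm :: "(nat \<Rightarrow> 'a::real_normed_vector) \<Rightarrow> real" where
  "sup_norm f = (SUP n. norm (f n))"

definition lp_norm :: "real \<Rightarrow> (nat \<Rightarrow> 'a::real_normed_vector) \<Rightarrow> real" where
  "lp_norm p f = (\<Sum>k. norm (f k) powr p) powr (1 / p)"


section \<open>Operators on a sequence space\<close>

text \<open>A sequence space is given by its carrier \<open>X\<close> and its norm \<open>N\<close>; operators on it are
  functions on all sequences of which only the values on \<open>X\<close> matter.\<close>

definition bounded_operator_on ::
  "(nat \<Rightarrow> 'a::complex_normed_vector) set \<Rightarrow> ((nat \<Rightarrow> 'a) \<Rightarrow> real)
    \<Rightarrow> ((nat \<Rightarrow> 'a) \<Rightarrow> (nat \<Rightarrow> 'a)) \<Rightarrow> bool" where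
  "bounded_operator_on X N T \<longleftrightarrow>
     (\<forall>f\<in>X. T f \<in> X) \<and>
     (\<forall>f\<in>X. \<forall>g\<in>X. T (\<lambda>n. f n + g n) = (\<lambda>n. T f n + T g n)) \<and>
     (\<forall>a. \<forall>f\<in>X. T (\<lambda>n. a *\<^sub>C f n) = (\<lambda>n. a *\<^sub>C T f n)) \<and>
     (\<exists>c. \<forall>f\<in>X. N (T f) \<le> c * N f)"

definition resolvent_set ::
  "(nat \<Rightarrow> 'a::complex_normed_vector) set \<Rightarrow> ((nat \<Rightarrow> 'a) \<Rightarrow> real)
    \<Rightarrow> ((nat \<Rightarrow> 'a) \<Rightarrow> (nat \<Rightarrow> 'a)) \<Rightarrow> complex set" where
  "resolvent_set X N T =
     {z. \<exists>S. bounded_operator_on X N S \<and>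
         (\<forall>f\<in>X. S (\<lambda>n. z *\<^sub>C f n - T f n) = f \<and> (\<lambda>n. z *\<^sub>C S f n - T (S f) n) = f)}"

definition spectrum ::
  "(nat \<Rightarrow> 'a::complex_normed_vector) set \<Rightarrow> ((nat \<Rightarrow> 'a) \<Rightarrow> real)
    \<Rightarrow> ((nat \<Rightarrow> 'a) \<Rightarrow> (nat \<Rightarrow> 'a)) \<Rightarrow> complex set" where
  "spectrum X N T = - resolvent_set X N T"

text \<open>Extended-real valued, so that the supremum is meaningful before the spectrum is known to be
  nonempty and bounded.\<close>

definition spectral_radius ::
  "(nat \<Rightarrow> 'a::complex_normed_vector) set \<Rightarrow> ((nat \<Rightarrow> 'a) \<Rightarrow> real)
    \<Rightarrow> ((nat \<Rightarrow> 'a) \<Rightarrow> (nat \<Rightarrow> 'a)) \<Rightarrow> ereal" where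
  "spectral_radius X N T = (SUP z\<in>spectrum X N T. ereal (cmod z))"


section \<open>Discrete evolution families\<close>

text \<open>\<open>'a \<Rightarrow>\<^sub>L 'a\<close> consists of the bounded real-linear operators, so complex homogeneity is required
  separately; the operator norm is the same. The values \<open>U n m\<close> with \<open>n < m\<close> are irrelevant.\<close>

definition evolution_family :: "(nat \<Rightarrow> nat \<Rightarrow> 'a::complex_normed_vector \<Rightarrow>\<^sub>L 'a) \<Rightarrow> bool" where
  "evolution_family U \<longleftrightarrow>
     (\<forall>n m. m \<le> n \<longrightarrow> (\<forall>a x. blinfun_apply (U n m) (a *\<^sub>C x) = a *\<^sub>C blinfun_apply (U n m) x)) \<and>
     (\<forall>m. U m m = id_blinfun) \<and>
     (\<forall>m p n. n \<le> p \<and> p \<le> m \<longrightarrow> U m n = U m p o\<^sub>L U p n)"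

definition growth_exponents :: "(nat \<Rightarrow> nat \<Rightarrow> 'a::real_normed_vector \<Rightarrow>\<^sub>L 'a) \<Rightarrow> real set" where
  "growth_exponents U =
     {\<omega>. bdd_above {exp (- \<omega> * (real n - real m)) * norm (U n m) | n m. m \<le> n}}"

definition exponentially_bounded :: "(nat \<Rightarrow> nat \<Rightarrow> 'a::real_normed_vector \<Rightarrow>\<^sub>L 'a) \<Rightarrow> bool" where
  "exponentially_bounded U \<longleftrightarrow> growth_exponents U \<noteq> {}"

definition growth_bound :: "(nat \<Rightarrow> nat \<Rightarrow> 'a::real_normed_vector \<Rightarrow>\<^sub>L 'a) \<Rightarrow> ereal" where
  "growth_bound U = (INF \<omega>\<in>growth_exponents U. ereal \<omega>)"

definition evolution_semigroup ::
  "(nat \<Rightarrow> nat \<Rightarrow> 'a::real_normed_vector \<Rightarrow>\<^sub>L 'a) \<Rightarrow> nat \<Rightarrow> (nat \<Rightarrow> 'a) \<Rightarrow> (nat \<Rightarrow> 'a)" where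
  "evolution_semigroup U j f =
     (\<lambda>k. if j \<le> k then blinfun_apply (U k (k - j)) (f (k - j)) else 0)"

definition convolution ::
  "(nat \<Rightarrow> nat \<Rightarrow> 'a::real_normed_vector \<Rightarrow>\<^sub>L 'a) \<Rightarrow> (nat \<Rightarrow> 'a) \<Rightarrow> (nat \<Rightarrow> 'a)" where
  "convolution U f = (\<lambda>k. \<Sum>j=0..k. blinfun_apply (U k j) (f j))"

definition convolution_domain ::
  "(nat \<Rightarrow> nat \<Rightarrow> 'a::real_normed_vector \<Rightarrow>\<^sub>L 'a) \<Rightarrow> (nat \<Rightarrow> 'a) set \<Rightarrow> (nat \<Rightarrow> 'a) set" where
  "convolution_domain U X = {f \<in> X. convolution U f \<in> X}"

end

theory Submission
  imports Defs
begin

text \<open>The three spaces are solid, translation invariant and satisfy a countable triangle inequality,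
  and the argument uses nothing else. A bound \<open>norm (U n m) \<le> M * q ^ (n - m)\<close> with \<open>q < 1\<close> makes every
  kernel of this size act boundedly; this covers the convolution and the Neumann series of the
  resolvent at all \<open>z\<close> with \<open>cmod z > q\<close>. If 1 is in the resolvent set, then the convolution is
  the resolvent at 1 and preserves the space. If the convolution preserves the space, uniform
  boundedness yields a constant \<open>c\<close> for all its truncations; applied to a point mass at \<open>m\<close> and then
  to the resulting truncated trajectory, it gives \<open>(n - m + 1) * norm (U n m) \<le> c\<^sup>2\<close>. Hence
  \<open>norm (U (m + L) m) \<le> 1/2\<close> for some \<open>L\<close> and all \<open>m \<ge> 1\<close>, and iterating gives exponential decay.
  The sequences in the space vanish at 0, so \<open>U n 0\<close> has to be factored through \<open>U 1 0\<close>.\<close>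

section \<open>Solid translation-invariant sequence spaces\<close>

text \<open>The endpoint 0 must be included because the entries in \<open>Minkowski_sum\<close> may
  vanish. If \<open>x\<close> or \<open>y\<close> is 0, the claim reduces to
  \<open>s powr p <= s\<close> for \<open>s\<close> in the unit interval.\<close>

lemma convex_on_powr_nonneg:
  fixes p :: real
  assumes "p \<ge> 1"
  shows "convex_on {0..} (\<lambda>x. x powr p)"
proof (rule convex_onI)
  fix t x y :: real
  assume t: "0 < t" "t < 1" and xy: "x \<in> {0..}" "y \<in> {0..}"
  have scaled: "(s * z) powr p \<le> s * z powr p" if "0 \<le> s" "s \<le> 1" "0 \<le> z" for s z :: real
  proof -
    have "s powr p \<le> s"
      using powr_mono'[of 1 p s] that assms by simp
    then show ?thesis
      using that by (simp add: powr_mult mult_right_mono)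
  qed
  consider "x = 0" | "y = 0" | "0 < x" "0 < y"
    using xy by fastforce
  then show "((1 - t) *\<^sub>R x + t *\<^sub>R y) powr p \<le> (1 - t) * x powr p + t * y powr p"
  proof cases
    case 3
    then show ?thesis
      using convex_onD[OF powr_convex[OF assms], of t x y] t by auto
  qed (use scaled[of t y] scaled[of "1 - t" x] t xy assms in auto)
qed simp

text \<open>Jensen's inequality for the quotients \<open>a i k / s i\<close> with weights
  \<open>s i / S\<close>; summed over \<open>k\<close>, each normalised row contributes at most its
  weight. Working with upper bounds \<open>s i\<close> instead of the norms of the rows lets a
  finite window \<open>K\<close> be combined with full \<open>lp_norm\<close> values.\<close>

lemma Minkowski_sum:
  fixes a :: "'i \<Rightarrow> 'k \<Rightarrow> real"
  assumes p: "p \<ge> 1" and I: "finite I" and K: "finite K"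
    and s: "\<And>i. i \<in> I \<Longrightarrow> 0 \<le> s i"
    and a: "\<And>i k. i \<in> I \<Longrightarrow> k \<in> K \<Longrightarrow> 0 \<le> a i k"
    and le: "\<And>i. i \<in> I \<Longrightarrow> (\<Sum>k\<in>K. a i k powr p) \<le> s i powr p"
  shows "(\<Sum>k\<in>K. (\<Sum>i\<in>I. a i k) powr p) \<le> (\<Sum>i\<in>I. s i) powr p"
proof -
  \<comment> \<open>Division by \<open>s i\<close> is only possible on \<open>J\<close>. Outside
    \<open>J\<close> the bound forces the whole row to vanish, so nothing is lost.\<close>
  define J where "J = {i \<in> I. s i \<noteq> 0}"
  define S where "S = (\<Sum>i\<in>J. s i)"
  have J: "finite J" "J \<subseteq> I" and sJ: "\<And>i. i \<in> J \<Longrightarrow> 0 < s i"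
    using I s by (auto simp: J_def order_less_le)
  have vanish: "a i k = 0" if "i \<in> I" "i \<notin> J" "k \<in> K" for i k
  proof -
    have "(\<Sum>k\<in>K. a i k powr p) = 0"
      using le[OF that(1)] that p by (intro antisym sum_nonneg) (auto simp: J_def)
    then show ?thesis
      using K that(3) by (simp add: sum_nonneg_eq_0_iff)
  qed
  have S_eq: "(\<Sum>i\<in>I. s i) = S"
    unfolding S_def by (rule sum.mono_neutral_right) (use I in \<open>auto simp: J_def\<close>)
  have a_eq: "(\<Sum>i\<in>I. a i k) = (\<Sum>i\<in>J. a i k)" if "k \<in> K" for k
    by (rule sum.mono_neutral_right) (use I J vanish that in auto)
  show ?thesis
  proof (cases "J = {}")
    case True
    then show ?thesis
      using p by (simp add: S_eq S_def a_eq)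
  next
    case False
    have S: "0 < S"
      unfolding S_def using J False sJ by (intro sum_pos) auto
    have "(\<Sum>i\<in>J. a i k) powr p \<le> S powr p * (\<Sum>i\<in>J. s i / S * (a i k powr p / s i powr p))"
      if k: "k \<in> K" for k
    proof -
      have "(\<Sum>i\<in>J. (s i / S) *\<^sub>R (a i k / s i)) powr p \<le> (\<Sum>i\<in>J. s i / S * (a i k / s i) powr p)"
      proof (rule convex_on_sum[OF J(1) False convex_on_powr_nonneg[OF p]])
        show "(\<Sum>i\<in>J. s i / S) = 1"
          using S by (simp add: S_def flip: sum_divide_distrib)
      qed (use S sJ a J k in \<open>auto simp: less_imp_le\<close>)
      also have "(\<Sum>i\<in>J. (s i / S) *\<^sub>R (a i k / s i)) = (\<Sum>i\<in>J. a i k) / S"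
        unfolding sum_divide_distrib by (intro sum.cong) (auto simp: J_def)
      also have "(\<Sum>i\<in>J. s i / S * (a i k / s i) powr p)
          = (\<Sum>i\<in>J. s i / S * (a i k powr p / s i powr p))"
        using sJ a J k by (intro sum.cong) (auto simp: powr_divide less_imp_le)
      finally have "((\<Sum>i\<in>J. a i k) / S) powr p \<le> \<dots>" .
      moreover have "((\<Sum>i\<in>J. a i k) / S) powr p = (\<Sum>i\<in>J. a i k) powr p / S powr p"
        by (rule powr_divide)
      ultimately show ?thesis
        using S by (simp add: divide_le_eq mult.commute)
    qed
    then have "(\<Sum>k\<in>K. (\<Sum>i\<in>I. a i k) powr p)
        \<le> (\<Sum>k\<in>K. S powr p * (\<Sum>i\<in>J. s i / S * (a i k powr p / s i powr p)))"
      by (intro sum_mono) (simp add: a_eq)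
    also have "\<dots> = S powr p * (\<Sum>i\<in>J. \<Sum>k\<in>K. s i / S * (a i k powr p / s i powr p))"
      by (subst sum.swap) (simp add: sum_distrib_left)
    also have "\<dots> = S powr p * (\<Sum>i\<in>J. s i / S * ((\<Sum>k\<in>K. a i k powr p) / s i powr p))"
      by (simp add: sum_distrib_left sum_divide_distrib)
    also have "\<dots> \<le> S powr p * (\<Sum>i\<in>J. s i / S * 1)"
      using S sJ J le by (intro mult_left_mono sum_mono) (auto simp: less_imp_le divide_le_eq)
    also have "\<dots> = S powr p"
      using S by (simp add: S_def flip: sum_divide_distrib)
    finally show ?thesis
      by (simp add: S_eq)
  qed
qed

text \<open>\<open>countable_triangle\<close> packs completeness and the triangle inequality into
  one axiom, with the limit taken coordinatewise. \<open>scale\<close> asks only for an inequality;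
  exact homogeneity and the binary triangle inequality are derived below. Point masses start at 1
  since all members vanish at 0.\<close>

locale banach_sequence_space =
  fixes X :: "(nat \<Rightarrow> 'a::banach) set" and N :: "(nat \<Rightarrow> 'a) \<Rightarrow> real"
  assumes at_0: "f \<in> X \<Longrightarrow> f 0 = 0"
    and norm_le: "f \<in> X \<Longrightarrow> norm (f k) \<le> N f"
    and solid: "f \<in> X \<Longrightarrow> g 0 = 0 \<Longrightarrow> (\<And>k. norm (g k) \<le> norm (f k)) \<Longrightarrow> g \<in> X \<and> N g \<le> N f"
    and scale: "f \<in> X \<Longrightarrow> (\<lambda>k. c *\<^sub>R f k) \<in> X \<and> N (\<lambda>k. c *\<^sub>R f k) \<le> \<bar>c\<bar> * N f"
    and shift: "f \<in> X \<Longrightarrow>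
      (\<lambda>k. if k < i then 0 else f (k - i)) \<in> X \<and> N (\<lambda>k. if k < i then 0 else f (k - i)) \<le> N f"
    and single: "0 < m \<Longrightarrow>
      (\<lambda>k. if k = m then x else 0) \<in> X \<and> N (\<lambda>k. if k = m then x else 0) \<le> norm x"
    and countable_triangle: "(\<And>i. F i \<in> X) \<Longrightarrow> summable (\<lambda>i. N (F i)) \<Longrightarrow>
      (\<lambda>k. \<Sum>i. F i k) \<in> X \<and> N (\<lambda>k. \<Sum>i. F i k) \<le> (\<Sum>i. N (F i))"

section \<open>The two spaces with the sup norm\<close>

lemma linf0_sup_normI:
  assumes "f 0 = 0" "\<And>k. norm (f k) \<le> C"
  shows "f \<in> linf0 \<and> sup_norm f \<le> C"
  unfolding linf0_def sup_norm_def using assms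
  by (auto intro!: boundedI cSUP_least)

lemma norm_le_sup_norm:
  assumes "f \<in> linf0"
  shows "norm (f k) \<le> sup_norm f"
proof -
  have "bounded (range f)"
    using assms by (simp add: linf0_def)
  then have "bdd_above (range (\<lambda>k. norm (f k)))"
    by (auto simp: bounded_iff bdd_above_def)
  then show ?thesis
    unfolding sup_norm_def by (intro cSUP_upper) auto
qed

lemma linf0_suminf:
  fixes F :: "nat \<Rightarrow> nat \<Rightarrow> 'a::banach"
  assumes F: "\<And>i. F i \<in> linf0" and sm: "summable (\<lambda>i. sup_norm (F i))"
  shows "(\<lambda>k. \<Sum>i. F i k) \<in> linf0 \<and> sup_norm (\<lambda>k. \<Sum>i. F i k) \<le> (\<Sum>i. sup_norm (F i))"
proof (rule linf0_sup_normI)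
  show "(\<Sum>i. F i 0) = 0"
    using F by (simp add: linf0_def)
  fix k
  have le: "norm (F i k) \<le> sup_norm (F i)" for i
    using norm_le_sup_norm[OF F] .
  then have "summable (\<lambda>i. norm (F i k))"
    by (intro summable_comparison_test'[OF sm]) auto
  then show "norm (\<Sum>i. F i k) \<le> (\<Sum>i. sup_norm (F i))"
    using summable_norm[of "\<lambda>i. F i k"] suminf_le[OF le _ sm] by linarith
qed

interpretation linf0: banach_sequence_space "linf0 :: (nat \<Rightarrow> 'a::banach) set" sup_norm
proof
  fix f g :: "nat \<Rightarrow> 'a" and F :: "nat \<Rightarrow> nat \<Rightarrow> 'a" and c :: real and i m k :: nat and x :: 'a
  show "f 0 = 0" if "f \<in> linf0"
    using that by (simp add: linf0_def)
  show "norm (f k) \<le> sup_norm f" if "f \<in> linf0"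
    using norm_le_sup_norm[OF that] .
  show "g \<in> linf0 \<and> sup_norm g \<le> sup_norm f"
    if "f \<in> linf0" "g 0 = 0" "\<And>k. norm (g k) \<le> norm (f k)"
    using that norm_le_sup_norm[OF that(1)] by (intro linf0_sup_normI) (auto intro: order_trans)
  show "(\<lambda>k. c *\<^sub>R f k) \<in> linf0 \<and> sup_norm (\<lambda>k. c *\<^sub>R f k) \<le> \<bar>c\<bar> * sup_norm f" if "f \<in> linf0"
    using norm_le_sup_norm[OF that] that
    by (intro linf0_sup_normI) (auto simp: linf0_def mult_left_mono)
  show "(\<lambda>k. if k < i then 0 else f (k - i)) \<in> linf0 \<and>
    sup_norm (\<lambda>k. if k < i then 0 else f (k - i)) \<le> sup_norm f" if "f \<in> linf0"
    using norm_le_sup_norm[OF that] that order_trans[OF norm_ge_zero norm_le_sup_norm[OF that]]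
    by (intro linf0_sup_normI) (auto simp: linf0_def)
  show "(\<lambda>k. if k = m then x else 0) \<in> linf0 \<and> sup_norm (\<lambda>k. if k = m then x else 0) \<le> norm x"
    if "0 < m"
    using that by (intro linf0_sup_normI) auto
  show "(\<lambda>k. \<Sum>i. F i k) \<in> linf0 \<and> sup_norm (\<lambda>k. \<Sum>i. F i k) \<le> (\<Sum>i. sup_norm (F i))"
    if "\<And>i. F i \<in> linf0" "summable (\<lambda>i. sup_norm (F i))"
    using linf0_suminf that by blast
qed

interpretation c00: banach_sequence_space "c00 :: (nat \<Rightarrow> 'a::banach) set" sup_norm
proof
  fix f g :: "nat \<Rightarrow> 'a" and F :: "nat \<Rightarrow> nat \<Rightarrow> 'a" and c :: real and i m k :: nat and x :: 'a
  show "f 0 = 0" if "f \<in> c00"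
    using that linf0.at_0 by (auto simp: c00_def)
  show "norm (f k) \<le> sup_norm f" if "f \<in> c00"
    using that linf0.norm_le by (auto simp: c00_def)
  show "g \<in> c00 \<and> sup_norm g \<le> sup_norm f"
    if "f \<in> c00" "g 0 = 0" "\<And>k. norm (g k) \<le> norm (f k)"
  proof -
    have "g \<longlonglongrightarrow> 0"
      by (rule Lim_null_comparison[of g "\<lambda>k. norm (f k)"])
        (use that in \<open>auto simp: c00_def tendsto_norm_zero\<close>)
    then show ?thesis
      using that linf0.solid[of f g] by (auto simp: c00_def)
  qed
  show "(\<lambda>k. c *\<^sub>R f k) \<in> c00 \<and> sup_norm (\<lambda>k. c *\<^sub>R f k) \<le> \<bar>c\<bar> * sup_norm f" if "f \<in> c00"
    using that linf0.scale[of f c] by (auto simp: c00_def intro!: tendsto_eq_intros)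
  show "(\<lambda>k. if k < i then 0 else f (k - i)) \<in> c00 \<and>
    sup_norm (\<lambda>k. if k < i then 0 else f (k - i)) \<le> sup_norm f" if "f \<in> c00"
  proof -
    have "(\<lambda>k. if k < i then 0 else f (k - i)) \<longlonglongrightarrow> 0"
      by (rule LIMSEQ_offset[where k = i]) (use that in \<open>simp add: c00_def\<close>)
    then show ?thesis
      using that linf0.shift[of f i] by (auto simp: c00_def)
  qed
  show "(\<lambda>k. if k = m then x else 0) \<in> c00 \<and> sup_norm (\<lambda>k. if k = m then x else 0) \<le> norm x"
    if "0 < m"
  proof -
    have "(\<lambda>k. if k = m then x else 0) \<longlonglongrightarrow> 0"
      by (rule tendsto_eventually, rule eventually_mono[OF eventually_gt_at_top[of m]]) simp
    then show ?thesis
      using that linf0.single[of m x] by (auto simp: c00_def)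
  qed
  show "(\<lambda>k. \<Sum>i. F i k) \<in> c00 \<and> sup_norm (\<lambda>k. \<Sum>i. F i k) \<le> (\<Sum>i. sup_norm (F i))"
    if F: "\<And>i. F i \<in> c00" and sm: "summable (\<lambda>i. sup_norm (F i))"
  proof -
    have le: "norm (F i k) \<le> sup_norm (F i)" for i k
      using F linf0.norm_le by (auto simp: c00_def)
    \<comment> \<open>Tannery's theorem exchanges the limit in \<open>k\<close> with the sum over
      \<open>i\<close>, dominated by \<open>sup_norm (F i)\<close>. Only the null limit is new here;
      the norm bound is inherited from \<open>linf0\<close>.\<close>
    have "(\<lambda>k. \<Sum>i. norm (F i k)) \<longlonglongrightarrow> (\<Sum>i. 0)"
    proof (rule tannerys_theorem[THEN conjunct2, THEN conjunct2])
      show "(\<lambda>k. norm (F i k)) \<longlonglongrightarrow> 0" for i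
        using F by (simp add: c00_def tendsto_norm_zero)
      show "\<forall>\<^sub>F (i, k) in sequentially \<times>\<^sub>F sequentially. norm (norm (F i k)) \<le> sup_norm (F i)"
        using le by (simp add: case_prod_unfold)
    qed (use sm in auto)
    moreover have "norm (\<Sum>i. F i k) \<le> (\<Sum>i. norm (F i k))" for k
      by (rule summable_norm[OF summable_comparison_test'[OF sm]]) (use le in simp)
    ultimately have "(\<lambda>k. \<Sum>i. F i k) \<longlonglongrightarrow> 0"
      using Lim_null_comparison[of "\<lambda>k. \<Sum>i. F i k" "\<lambda>k. \<Sum>i. norm (F i k)"] by simp
    then show ?thesis
      using linf0_suminf[of F] F sm by (simp add: c00_def)
  qed
qed

section \<open>The spaces of p-summable sequences\<close>

text \<open>A bound on all partial sums yields membership and the norm estimate together, so each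
  axiom reduces to an inequality between finite sums.\<close>

lemma lp0_lp_normI:
  assumes p: "p \<ge> 1" and "f 0 = 0" "0 \<le> C" "\<And>n. (\<Sum>k<n. norm (f k) powr p) \<le> C powr p"
  shows "f \<in> lp0 p \<and> lp_norm p f \<le> C"
proof
  have sm: "summable (\<lambda>k. norm (f k) powr p)"
    using assms(4) by (intro summableI_nonneg_bounded) auto
  then show "f \<in> lp0 p"
    using assms(2) by (simp add: lp0_def)
  have "(\<Sum>k. norm (f k) powr p) \<le> C powr p"
    using sm assms(4) by (rule suminf_le_const)
  then have "lp_norm p f \<le> (C powr p) powr (1 / p)"
    unfolding lp_norm_def using p sm by (intro powr_mono2 suminf_nonneg) auto
  then show "lp_norm p f \<le> C"
    using p assms(3) by (simp add: powr_powr)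
qed

lemma lp_norm_nonneg: "0 \<le> lp_norm p f"
  by (simp add: lp_norm_def)

lemma sum_powr_le_lp_norm:
  assumes "p \<ge> 1" "f \<in> lp0 p" "finite K"
  shows "(\<Sum>k\<in>K. norm (f k) powr p) \<le> lp_norm p f powr p"
proof -
  have sm: "summable (\<lambda>k. norm (f k) powr p)"
    using assms by (simp add: lp0_def)
  have "(\<Sum>k\<in>K. norm (f k) powr p) \<le> (\<Sum>k. norm (f k) powr p)"
    using sm assms by (intro sum_le_suminf) auto
  also have "\<dots> = lp_norm p f powr p"
    using assms sm by (simp add: lp_norm_def powr_powr suminf_nonneg)
  finally show ?thesis .
qed

lemma norm_le_lp_norm:
  assumes p: "p \<ge> 1" and "f \<in> lp0 p"
  shows "norm (f k) \<le> lp_norm p f"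
proof -
  have "norm (f k) powr p \<le> lp_norm p f powr p"
    using sum_powr_le_lp_norm[OF assms, of "{k}"] by simp
  then show ?thesis
    using p powr_le_cancel_iff lp_norm_nonneg
    by (smt (verit) norm_ge_zero powr_less_mono2)
qed

lemma banach_sequence_space_lp0:
  assumes p: "p \<ge> 1"
  shows "banach_sequence_space (lp0 p :: (nat \<Rightarrow> 'a::banach) set) (lp_norm p)"
proof
  fix f g :: "nat \<Rightarrow> 'a" and F :: "nat \<Rightarrow> nat \<Rightarrow> 'a" and c :: real and i m k :: nat and x :: 'a
  show "f 0 = 0" if "f \<in> lp0 p"
    using that by (simp add: lp0_def)
  show "norm (f k) \<le> lp_norm p f" if "f \<in> lp0 p"
    using norm_le_lp_norm[OF p that] .
  show "g \<in> lp0 p \<and> lp_norm p g \<le> lp_norm p f"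
    if "f \<in> lp0 p" "g 0 = 0" "\<And>k. norm (g k) \<le> norm (f k)"
  proof (rule lp0_lp_normI[OF p])
    fix n
    have "(\<Sum>k<n. norm (g k) powr p) \<le> (\<Sum>k<n. norm (f k) powr p)"
      using that(3) p by (intro sum_mono powr_mono2) auto
    then show "(\<Sum>k<n. norm (g k) powr p) \<le> lp_norm p f powr p"
      using sum_powr_le_lp_norm[OF p that(1), of "{..<n}"] by simp
  qed (use that lp_norm_nonneg in auto)
  show "(\<lambda>k. c *\<^sub>R f k) \<in> lp0 p \<and> lp_norm p (\<lambda>k. c *\<^sub>R f k) \<le> \<bar>c\<bar> * lp_norm p f"
    if "f \<in> lp0 p"
  proof (rule lp0_lp_normI[OF p])
    fix n
    show "(\<Sum>k<n. norm (c *\<^sub>R f k) powr p) \<le> (\<bar>c\<bar> * lp_norm p f) powr p"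
      using sum_powr_le_lp_norm[OF p that, of "{..<n}"]
      by (simp add: powr_mult lp_norm_nonneg mult_left_mono flip: sum_distrib_left)
  qed (use that in \<open>auto simp: lp0_def lp_norm_nonneg\<close>)
  show "(\<lambda>k. if k < i then 0 else f (k - i)) \<in> lp0 p \<and>
    lp_norm p (\<lambda>k. if k < i then 0 else f (k - i)) \<le> lp_norm p f" if "f \<in> lp0 p"
  proof (rule lp0_lp_normI[OF p])
    fix n
    have "(\<Sum>k<n. norm (if k < i then 0 else f (k - i)) powr p)
        = (\<Sum>k\<in>{i..<n}. norm (f (k - i)) powr p)"
      using p by (intro sum.mono_neutral_cong_right) auto
    also have "\<dots> = (\<Sum>k<n - i. norm (f k) powr p)"
      by (rule sum.reindex_bij_witness[of _ "\<lambda>k. k + i" "\<lambda>k. k - i"]) auto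
    also have "\<dots> \<le> lp_norm p f powr p"
      using sum_powr_le_lp_norm[OF p that] by simp
    finally show "(\<Sum>k<n. norm (if k < i then 0 else f (k - i)) powr p) \<le> lp_norm p f powr p" .
  qed (use that lp_norm_nonneg in \<open>auto simp: lp0_def\<close>)
  show "(\<lambda>k. if k = m then x else 0) \<in> lp0 p \<and> lp_norm p (\<lambda>k. if k = m then x else 0) \<le> norm x"
    if "0 < m"
  proof (rule lp0_lp_normI[OF p])
    fix n
    have "(\<Sum>k<n. norm (if k = m then x else 0) powr p) = (\<Sum>k<n. if k = m then norm x powr p else 0)"
      using p by (intro sum.cong) auto
    then show "(\<Sum>k<n. norm (if k = m then x else 0) powr p) \<le> norm x powr p"
      by (simp add: sum.delta)
  qed (use that in auto)
  show "(\<lambda>k. \<Sum>i. F i k) \<in> lp0 p \<and> lp_norm p (\<lambda>k. \<Sum>i. F i k) \<le> (\<Sum>i. lp_norm p (F i))"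
    if F: "\<And>i. F i \<in> lp0 p" and sm: "summable (\<lambda>i. lp_norm p (F i))"
  proof (rule lp0_lp_normI[OF p])
    show "(\<Sum>i. F i 0) = 0"
      using F by (simp add: lp0_def)
    show "0 \<le> (\<Sum>i. lp_norm p (F i))"
      using sm lp_norm_nonneg by (rule suminf_nonneg)
    fix n
    have sm_k: "summable (\<lambda>i. norm (F i k))" for k
      by (rule summable_comparison_test'[OF sm]) (simp add: norm_le_lp_norm[OF p F])
    \<comment> \<open>Minkowski applies to finitely many summands \<open>i < l\<close> on a finite
      window \<open>k < n\<close>. The window stays fixed while \<open>l\<close> tends to
      infinity.\<close>
    have "(\<lambda>l. \<Sum>k<n. (\<Sum>i<l. norm (F i k)) powr p) \<longlonglongrightarrow> (\<Sum>k<n. (\<Sum>i. norm (F i k)) powr p)"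
      by (intro tendsto_sum tendsto_powr' summable_LIMSEQ sm_k tendsto_const)
        (use p in \<open>auto intro!: always_eventually sum_nonneg\<close>)
    moreover have "(\<Sum>k<n. (\<Sum>i<l. norm (F i k)) powr p) \<le> (\<Sum>i. lp_norm p (F i)) powr p" for l
    proof -
      have "(\<Sum>k<n. (\<Sum>i<l. norm (F i k)) powr p) \<le> (\<Sum>i<l. lp_norm p (F i)) powr p"
        by (rule Minkowski_sum[OF p]) (auto simp: lp_norm_nonneg sum_powr_le_lp_norm[OF p F])
      also have "\<dots> \<le> (\<Sum>i. lp_norm p (F i)) powr p"
        using p sm lp_norm_nonneg by (intro powr_mono2 sum_le_suminf sum_nonneg) auto
      finally show ?thesis .
    qed
    ultimately have "(\<Sum>k<n. (\<Sum>i. norm (F i k)) powr p) \<le> (\<Sum>i. lp_norm p (F i)) powr p"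
      by (intro LIMSEQ_le_const2) auto
    moreover have "(\<Sum>k<n. norm (\<Sum>i. F i k) powr p) \<le> (\<Sum>k<n. (\<Sum>i. norm (F i k)) powr p)"
      using p summable_norm[OF sm_k] by (intro sum_mono powr_mono2) auto
    ultimately show "(\<Sum>k<n. norm (\<Sum>i. F i k) powr p) \<le> (\<Sum>i. lp_norm p (F i)) powr p"
      by linarith
  qed
qed

section \<open>Consequences of the axioms: norm properties, uniform boundedness, exponential
  kernels\<close>

context banach_sequence_space
begin

lemma zero: "(\<lambda>_. 0) \<in> X" and N_zero: "N (\<lambda>_. 0) = 0"
proof -
  have *: "(\<lambda>_. 0) \<in> X \<and> N (\<lambda>_. 0) \<le> 0"
    using single[of 1 0] by simp
  then show "(\<lambda>_. 0) \<in> X" "N (\<lambda>_. 0) = 0"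
    using norm_le[of "\<lambda>_. 0" 0] by auto
qed

lemma N_nonneg: "f \<in> X \<Longrightarrow> 0 \<le> N f"
  by (rule order_trans[OF norm_ge_zero norm_le])

text \<open>Scaling back by \<open>1 / c\<close> gives the reverse of the inequality in
  \<open>scale\<close>.\<close>

lemma N_scale:
  assumes f: "f \<in> X"
  shows "N (\<lambda>k. c *\<^sub>R f k) = \<bar>c\<bar> * N f"
proof (cases "c = 0")
  case False
  have "N f \<le> \<bar>1 / c\<bar> * N (\<lambda>k. c *\<^sub>R f k)"
    using scale[of "\<lambda>k. c *\<^sub>R f k" "1 / c"] scale[OF f, of c] False by simp
  then have "\<bar>c\<bar> * N f \<le> N (\<lambda>k. c *\<^sub>R f k)"
    using False by (simp add: field_simps)
  then show ?thesis
    using scale[OF f, of c] by simp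
qed (simp add: N_zero)

lemma add:
  assumes f: "f \<in> X" and g: "g \<in> X"
  shows "(\<lambda>k. f k + g k) \<in> X \<and> N (\<lambda>k. f k + g k) \<le> N f + N g"
proof -
  \<comment> \<open>The binary case is the countable one for the series f, g, 0, 0, and so
    on.\<close>
  define F where "F i = (if i = 0 then f else if i = 1 then g else (\<lambda>_. 0))" for i :: nat
  have supp: "i \<notin> {..<2} \<Longrightarrow> F i = (\<lambda>_. 0)" for i
    by (auto simp: F_def)
  have "(\<lambda>i. N (F i)) sums (\<Sum>i<2. N (F i))"
    by (rule sums_finite) (auto simp: supp N_zero)
  moreover have "(\<Sum>i. F i k) = (\<Sum>i<2. F i k)" for k
    by (rule suminf_finite) (auto simp: supp)
  moreover have "F i \<in> X" for i
    using f g zero by (simp add: F_def)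
  ultimately show ?thesis
    using countable_triangle[of F]
    by (auto simp: F_def numeral_2_eq_2 sums_iff)
qed

text \<open>Truncations lie in the space whether or not \<open>g\<close> does: they are finite sums
  of point masses, and \<open>g 0 = 0\<close> disposes of index 0.\<close>

lemma finite_support:
  assumes "g 0 = 0"
  shows "(\<lambda>k. if k \<le> n then g k else 0) \<in> X \<and>
    N (\<lambda>k. if k \<le> n then g k else 0) \<le> (\<Sum>k\<le>n. norm (g k))"
proof (induction n)
  case 0
  then show ?case
    using assms zero N_zero by (simp cong: if_cong)
next
  case (Suc n)
  have "(\<lambda>k. if k \<le> Suc n then g k else 0)
      = (\<lambda>k. (if k \<le> n then g k else 0) + (if k = Suc n then g (Suc n) else 0))"
    by (auto simp: fun_eq_iff)
  then show ?case
    using add[OF Suc[THEN conjunct1] single[THEN conjunct1, of "Suc n" "g (Suc n)"]] Suc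
      single[of "Suc n" "g (Suc n)"] by auto
qed

text \<open>Sokal's proof: no Baire category, only rapidly shrinking perturbations \<open>x (Suc i) - x i\<close> chosen
  so small that later ones cannot undo the growth of an earlier seminorm.\<close>

lemma uniform_boundedness:
  fixes p :: "'i \<Rightarrow> (nat \<Rightarrow> 'a) \<Rightarrow> real"
  assumes p_add: "\<And>n f g. f \<in> X \<Longrightarrow> g \<in> X \<Longrightarrow> p n (\<lambda>k. f k + g k) \<le> p n f + p n g"
    and p_scale: "\<And>n c f. f \<in> X \<Longrightarrow> p n (\<lambda>k. c *\<^sub>R f k) = \<bar>c\<bar> * p n f"
    and p_bounded: "\<And>n. \<exists>C. \<forall>f\<in>X. p n f \<le> C * N f"
    and pointwise: "\<And>f. f \<in> X \<Longrightarrow> \<exists>B. \<forall>n. p n f \<le> B"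
  shows "\<exists>c. \<forall>n. \<forall>f\<in>X. p n f \<le> c * N f"
proof (rule ccontr)
  assume unbounded: "\<nexists>c. \<forall>n. \<forall>f\<in>X. p n f \<le> c * N f"
  \<comment> \<open>\<open>d\<close> is a budget for later perturbations: a perturbation of norm at
    most \<open>2 * d\<close> raises \<open>p n\<close> by at most 2.\<close>
  have small: "\<exists>d>0. d \<le> e \<and> (\<forall>f\<in>X. d * p n f \<le> N f)" if "e > 0" for e n
  proof -
    obtain C where C: "\<And>f. f \<in> X \<Longrightarrow> p n f \<le> C * N f"
      using p_bounded by blast
    define d where "d = min e (1 / (\<bar>C\<bar> + 1))"
    have d: "0 < d" "d * \<bar>C\<bar> \<le> 1"
      using that by (auto simp: d_def min_def field_simps)
    have "d * p n f \<le> N f" if f: "f \<in> X" for f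
    proof -
      have "p n f \<le> \<bar>C\<bar> * N f"
        using C[OF f] N_nonneg[OF f] mult_right_mono[OF abs_ge_self[of C], of "N f"] by linarith
      then have "d * p n f \<le> (d * \<bar>C\<bar>) * N f"
        using d(1) by (simp add: mult.assoc)
      also have "\<dots> \<le> 1 * N f"
        using d N_nonneg[OF f] by (intro mult_right_mono) auto
      finally show ?thesis by simp
    qed
    then show ?thesis
      using d(1) by (intro exI[of _ d]) (auto simp: d_def)
  qed
  \<comment> \<open>A seminorm large at \<open>v\<close> is large at one of \<open>x + v\<close> and \<open>x - v\<close>.\<close>
  have jump: "\<exists>u n. u \<in> X \<and> N u \<le> d \<and> B \<le> p n (\<lambda>k. x k + u k)"
    if x: "x \<in> X" and d: "d > 0" and B: "B \<ge> 0" for x d B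
  proof -
    \<comment> \<open>The threshold is chosen so that \<open>f\<close>, rescaled to norm
      \<open>d\<close>, has seminorm at least \<open>B\<close>.\<close>
    obtain n f where f: "f \<in> X" "p n f > B / d * N f"
      using unbounded by (meson not_le)
    obtain C where C: "p n f \<le> C * N f"
      using p_bounded f by blast
    \<comment> \<open>The rescaling divides by \<open>N f\<close>. If \<open>N f\<close> were 0,
      boundedness of \<open>p n\<close> would contradict the choice of \<open>f\<close>.\<close>
    have Nf: "0 < N f"
    proof (rule ccontr)
      assume "\<not> 0 < N f"
      then have "N f = 0"
        using N_nonneg[OF f(1)] by simp
      then show False
        using C f by simp
    qed
    define v where "v = (\<lambda>k. (d / N f) *\<^sub>R f k)"
    have v: "v \<in> X" "N v \<le> d"
      unfolding v_def using scale[OF f(1), of "d / N f"] Nf d by auto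
    have pv: "B \<le> p n v"
      unfolding v_def p_scale[OF f(1)] using f(2) Nf d by (simp add: field_simps)
    have nv: "(\<lambda>k. (-1) *\<^sub>R v k) \<in> X" "N (\<lambda>k. (-1) *\<^sub>R v k) \<le> d"
      using scale[OF v(1), of "-1"] v by auto
    have xv: "(\<lambda>k. x k + v k) \<in> X" "(\<lambda>k. x k + (-1) *\<^sub>R v k) \<in> X"
      using add[OF x v(1)] add[OF x nv(1)] by simp_all
    have nxv: "(\<lambda>k. (-1) *\<^sub>R (x k + (-1) *\<^sub>R v k)) \<in> X"
      using scale[OF xv(2), of "-1"] by simp
    have "2 * p n v = p n (\<lambda>k. 2 *\<^sub>R v k)"
      using p_scale[OF v(1), of n 2] by simp
    also have "(\<lambda>k. 2 *\<^sub>R v k) = (\<lambda>k. (x k + v k) + (-1) *\<^sub>R (x k + (-1) *\<^sub>R v k))"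
      by (simp add: fun_eq_iff scaleR_2)
    also have "p n \<dots> \<le> p n (\<lambda>k. x k + v k) + p n (\<lambda>k. x k + (-1) *\<^sub>R v k)"
      using p_add[OF xv(1) nxv, of n] p_scale[OF xv(2), of n "-1"] by simp
    finally consider "B \<le> p n (\<lambda>k. x k + v k)" | "B \<le> p n (\<lambda>k. x k + (-1) *\<^sub>R v k)"
      using pv by linarith
    then show ?thesis
    proof cases
      case 1
      then show ?thesis
        using v by (intro exI[of _ v] exI[of _ n]) simp
    next
      case 2
      then show ?thesis
        using nv by (intro exI[of _ "\<lambda>k. (-1) *\<^sub>R v k"] exI[of _ n]) simp
    qed
  qed
  \<comment> \<open>A state holds the current point, the remaining budget and the index of the
    seminorm that is large there. \<open>P\<close> describes stage \<open>i\<close>;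
    \<open>Q\<close> says that a step stays within the old budget and at least halves it.\<close>
  define P where "P i = (\<lambda>(x, d, n). x \<in> X \<and> d > 0 \<and> (\<forall>f\<in>X. d * p n f \<le> N f) \<and> real i \<le> p n x)"
    for i :: nat
  define Q where "Q = (\<lambda>(x, d, n :: 'i) (x', d', n' :: 'i). (\<lambda>k. x' k - x k) \<in> X \<and>
    N (\<lambda>k. x' k - x k) \<le> d \<and> d' \<le> d / 2)"
  have "\<exists>s. \<forall>i. P i (s i) \<and> Q (s i) (s (Suc i))"
  proof (rule dependent_nat_choice)
    \<comment> \<open>At stage 0 any index will do, since every seminorm vanishes at the zero
      sequence.\<close>
    obtain d where "d > 0" "\<forall>f\<in>X. d * p undefined f \<le> N f"
      using small[of 1 undefined] by auto
    then show "\<exists>s. P 0 s"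
      using zero p_scale[OF zero, of undefined 0]
      by (intro exI[of _ "(\<lambda>_. 0, d, undefined)"]) (simp add: P_def)
  next
    fix s i
    assume "P i s"
    then obtain x d n where s: "s = (x, d, n)" "x \<in> X" "d > 0"
      by (auto simp: P_def)
    obtain u n' where u: "u \<in> X" "N u \<le> d" "real (Suc i) \<le> p n' (\<lambda>k. x k + u k)"
      using jump[OF s(2,3), of "real (Suc i)"] by auto
    obtain d' where "d' > 0" "d' \<le> d / 2" "\<forall>f\<in>X. d' * p n' f \<le> N f"
      using small[of "d / 2" n'] s by auto
    then have "P (Suc i) (\<lambda>k. x k + u k, d', n') \<and> Q s (\<lambda>k. x k + u k, d', n')"
      using u s add[OF s(2) u(1)] by (simp add: P_def Q_def)
    then show "\<exists>s'. P (Suc i) s' \<and> Q s s'" ..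
  qed
  then obtain s where s: "\<And>i. P i (s i)" "\<And>i. Q (s i) (s (Suc i))"
    by blast
  define x d n where "x i = fst (s i)" and "d i = fst (snd (s i))" and "n i = snd (snd (s i))" for i
  have s_eq: "s i = (x i, d i, n i)" for i
    by (simp add: x_def d_def n_def)
  have x: "x i \<in> X" and d_pos: "d i > 0" and dp: "f \<in> X \<Longrightarrow> d i * p (n i) f \<le> N f"
    and px: "real i \<le> p (n i) (x i)" for i f
    using s(1)[of i] by (auto simp: P_def s_eq)
  define v where "v i = (\<lambda>k. x (Suc i) k - x i k)" for i
  have v: "v i \<in> X" "N (v i) \<le> d i" and d_Suc: "d (Suc i) \<le> d i / 2" for i
    using s(2)[of i] by (auto simp: Q_def s_eq v_def)
  have d_le: "d (i + l) \<le> d i * (1 / 2) ^ l" for i l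
  proof (induction l)
    case (Suc l)
    then show ?case
      using d_Suc[of "i + l"] by simp
  qed simp
  have geometric: "(\<lambda>l. d i * (1 / 2) ^ l) sums (d i * 2)" for i
    using sums_mult[OF geometric_sums[of "1 / 2 :: real"], of "d i"] by simp
  have summable_v: "summable (\<lambda>l. N (v (i + l)))" for i
    by (rule summable_comparison_test'[OF sums_summable[OF geometric[of i]]])
      (simp add: N_nonneg v order_trans[OF v(2) d_le])
  \<comment> \<open>\<open>y i\<close> collects all perturbations after stage \<open>i\<close>, so
    \<open>x i + y i\<close> is the same limit for every \<open>i\<close>. Halving the budgets gives
    \<open>N (y i) <= 2 * d i\<close>, hence \<open>p (n i)\<close> at the limit is at least
    \<open>i - 2\<close>.\<close>
  define y where "y i = (\<lambda>k. \<Sum>l. v (i + l) k)" for i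
  have y: "y i \<in> X" "N (y i) \<le> 2 * d i" for i
  proof -
    have "(\<Sum>l. N (v (i + l))) \<le> d i * 2"
      using order_trans[OF v(2) d_le] sums_unique[OF geometric[of i]]
        suminf_le[OF _ summable_v sums_summable[OF geometric[of i]]] by simp
    then show "y i \<in> X" "N (y i) \<le> 2 * d i"
      using countable_triangle[of "\<lambda>l. v (i + l)"] v(1) summable_v by (auto simp: y_def)
  qed
  have x_add_y: "x i k + y i k = x 0 k + y 0 k" for i k
  proof -
    have "summable (\<lambda>l. v l k)"
      by (rule summable_comparison_test'[of "\<lambda>l. N (v l)" 0])
        (use summable_v[of 0] norm_le[OF v(1)] in simp_all)
    then have "y 0 k = y i k + (\<Sum>l<i. v l k)"
      using suminf_split_initial_segment[of "\<lambda>l. v l k" i] by (simp add: y_def add.commute)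
    also have "(\<Sum>l<i. v l k) = x i k - x 0 k"
      unfolding v_def by (rule sum_lessThan_telescope)
    finally show ?thesis by simp
  qed
  define z where "z = (\<lambda>k. x 0 k + y 0 k)"
  have z: "z \<in> X"
    using add[OF x y(1)] by (simp add: z_def)
  have z_large: "real i \<le> p (n i) z + 2" for i
  proof -
    have ny: "(\<lambda>k. (-1) *\<^sub>R y i k) \<in> X"
      using scale[OF y(1), of "-1" i] by simp
    have "x i = (\<lambda>k. z k + (-1) *\<^sub>R y i k)"
      using x_add_y[of i] by (simp add: z_def fun_eq_iff algebra_simps)
    then have "p (n i) (x i) \<le> p (n i) z + p (n i) (y i)"
      using p_add[OF z ny, of "n i"] p_scale[OF y(1), of "n i" "-1" i] by simp
    moreover have "d i * p (n i) (y i) \<le> d i * 2"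
      using order_trans[OF dp[OF y(1)] y(2)] by (simp add: mult.commute)
    then have "p (n i) (y i) \<le> 2"
      using d_pos by simp
    ultimately show ?thesis
      using px[of i] by linarith
  qed
  obtain B where B: "\<And>n. p n z \<le> B"
    using pointwise[OF z] by blast
  obtain i where "B + 2 < real i"
    using reals_Archimedean2 by blast
  then show False
    using z_large[of i] B[of "n i"] by linarith
qed

text \<open>The sum is split along the diagonals \<open>i = k - j\<close>. Diagonal \<open>i\<close>
  is dominated by \<open>M * q ^ i\<close> times the shift of \<open>f\<close> by \<open>i\<close>,
  so the norms form a geometric series. The general array \<open>H\<close> serves both the
  convolution and the resolvent.\<close>

lemma exponential_kernel:
  assumes f: "f \<in> X" and M: "0 \<le> M" and q: "0 \<le> q" "q < 1"
    and H: "\<And>k j. j \<le> k \<Longrightarrow> norm (H k j) \<le> M * q ^ (k - j) * norm (f j)"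
  shows "(\<lambda>k. \<Sum>j\<le>k. H k j) \<in> X \<and> N (\<lambda>k. \<Sum>j\<le>k. H k j) \<le> M / (1 - q) * N f"
proof -
  define F where "F i k = (if i \<le> k then H k (k - i) else 0)" for i k
  have F: "F i \<in> X \<and> N (F i) \<le> M * q ^ i * N f" for i
  proof -
    let ?f = "\<lambda>k. if k < i then 0 else f (k - i)"
    let ?g = "\<lambda>k. (M * q ^ i) *\<^sub>R ?f k"
    have g: "?g \<in> X" "N ?g \<le> M * q ^ i * N ?f"
      using shift[OF f, of i] scale[of ?f "M * q ^ i"] M q by auto
    have "N ?g \<le> M * q ^ i * N f"
      using g(2) mult_left_mono[of "N ?f" "N f" "M * q ^ i"] shift[OF f, of i] M q by auto
    moreover have "norm (F i k) \<le> norm (?g k)" for k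
      using H[of "k - i" k] M q by (cases "i \<le> k") (simp_all add: F_def)
    \<comment> \<open>Solidity requires \<open>F i 0 = 0\<close>; this follows because the
      dominating sequence vanishes at 0.\<close>
    moreover from this[of 0] have "F i 0 = 0"
      using at_0[OF f] by (simp split: if_splits)
    ultimately show ?thesis
      using solid[OF g(1), of "F i"] by auto
  qed
  have geometric: "(\<lambda>i. M * q ^ i * N f) sums (M / (1 - q) * N f)"
    using sums_mult2[OF sums_mult[OF geometric_sums[of q], of M], of "N f"] q by simp
  have sm: "summable (\<lambda>i. N (F i))"
    by (rule summable_comparison_test'[OF sums_summable[OF geometric]]) (use F N_nonneg in auto)
  have "(\<Sum>i. N (F i)) \<le> M / (1 - q) * N f"
    using suminf_le[OF _ sm sums_summable[OF geometric]] F sums_unique[OF geometric] by auto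
  moreover have "(\<Sum>i. F i k) = (\<Sum>j\<le>k. H k j)" for k
  proof -
    have "(\<Sum>i. F i k) = (\<Sum>i\<le>k. F i k)"
      by (rule suminf_finite) (auto simp: F_def)
    also have "\<dots> = (\<Sum>j\<le>k. H k j)"
      by (rule sum.reindex_bij_witness[of _ "\<lambda>j. k - j" "\<lambda>i. k - i"]) (auto simp: F_def)
    finally show ?thesis .
  qed
  ultimately show ?thesis
    using countable_triangle[of F] F sm by auto
qed

end

section \<open>Exponential decay of evolution families\<close>

context banach_sequence_space
begin

text \<open>Uniform boundedness stands in for the closed graph theorem. Each truncation is bounded
  because it involves finitely many operators, and by solidity all truncations of
  \<open>convolution U f\<close> are bounded by its own norm.\<close>

lemma truncated_convolution_bounded:
  fixes U :: "nat \<Rightarrow> nat \<Rightarrow> 'a \<Rightarrow>\<^sub>L 'a"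
  assumes invariant: "\<And>f. f \<in> X \<Longrightarrow> convolution U f \<in> X"
  shows "\<exists>c. \<forall>n. \<forall>f\<in>X. N (\<lambda>k. if k \<le> n then convolution U f k else 0) \<le> c * N f"
proof (rule uniform_boundedness)
  let ?t = "\<lambda>n f k. if k \<le> n then convolution U f k else 0"
  have conv_0: "convolution U f 0 = 0" if "f \<in> X" for f
    using at_0[OF invariant[OF that]] .
  have tX: "?t n f \<in> X" if "f \<in> X" for n f
    using finite_support[of "convolution U f" n] conv_0[OF that] by simp
  fix n f g c
  assume f: "f \<in> X"
  have "?t n (\<lambda>k. c *\<^sub>R f k) = (\<lambda>k. c *\<^sub>R ?t n f k)"
    by (simp add: fun_eq_iff convolution_def blinfun.scaleR_right scaleR_sum_right)
  then show "N (?t n (\<lambda>k. c *\<^sub>R f k)) = \<bar>c\<bar> * N (?t n f)"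
    using N_scale[OF tX[OF f]] by simp
  show "\<exists>B. \<forall>n. N (?t n f) \<le> B"
    using solid[OF invariant[OF f]] conv_0[OF f] by (intro exI[of _ "N (convolution U f)"]) simp
  assume g: "g \<in> X"
  have "?t n (\<lambda>k. f k + g k) = (\<lambda>k. ?t n f k + ?t n g k)"
    by (simp add: fun_eq_iff convolution_def blinfun.add_right sum.distrib)
  then show "N (?t n (\<lambda>k. f k + g k)) \<le> N (?t n f) + N (?t n g)"
    using add[OF tX[OF f] tX[OF g]] by simp
next
  fix n
  let ?C = "\<Sum>k\<le>n. \<Sum>j=0..k. norm (U k j)"
  have "N (\<lambda>k. if k \<le> n then convolution U f k else 0) \<le> ?C * N f" if f: "f \<in> X" for f
  proof -
    have "norm (convolution U f k) \<le> (\<Sum>j=0..k. norm (U k j)) * N f" for k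
    proof -
      have "norm (convolution U f k) \<le> (\<Sum>j=0..k. norm (U k j) * N f)"
        unfolding convolution_def
        by (intro sum_norm_le order_trans[OF norm_blinfun] mult_left_mono norm_le f) auto
      then show ?thesis
        by (simp add: sum_distrib_right)
    qed
    then have "(\<Sum>k\<le>n. norm (convolution U f k)) \<le> ?C * N f"
      unfolding sum_distrib_right by (intro sum_mono) (simp add: sum_distrib_right)
    then show ?thesis
      using finite_support[of "convolution U f" n] at_0[OF invariant[OF f]] by linarith
  qed
  then show "\<exists>C. \<forall>f\<in>X. N (\<lambda>k. if k \<le> n then convolution U f k else 0) \<le> C * N f"
    by blast
qed

text \<open>The convolution applied to a trajectory of length \<open>n - m + 1\<close> reproduces its end point
  \<open>n - m + 1\<close> times, and the trajectory is itself the truncated convolution of a point mass.\<close>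

lemma evolution_family_linear_decay:
  fixes U :: "nat \<Rightarrow> nat \<Rightarrow> 'a \<Rightarrow>\<^sub>L 'a"
  assumes comp: "\<And>m p n. n \<le> p \<Longrightarrow> p \<le> m \<Longrightarrow> U m n = U m p o\<^sub>L U p n"
    and invariant: "\<And>f. f \<in> X \<Longrightarrow> convolution U f \<in> X"
  shows "\<exists>K\<ge>0. \<forall>n m. 1 \<le> m \<longrightarrow> m \<le> n \<longrightarrow> real (Suc (n - m)) * norm (U n m) \<le> K"
proof -
  let ?t = "\<lambda>n f k. if k \<le> n then convolution U f k else 0"
  obtain c0 where c0: "\<And>n f. f \<in> X \<Longrightarrow> N (?t n f) \<le> c0 * N f"
    using truncated_convolution_bounded[OF invariant] by metis
  define c where "c = \<bar>c0\<bar>"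
  have c: "N (?t n f) \<le> c * N f" if "f \<in> X" for n f
    using c0[OF that, of n] mult_right_mono[OF abs_ge_self[of c0] N_nonneg[OF that]]
    unfolding c_def by linarith
  have c_nonneg: "0 \<le> c"
    by (simp add: c_def)
  have "real (Suc (n - m)) * norm (U n m) \<le> c * c" if m: "1 \<le> m" "m \<le> n" for n m
  proof -
    have "norm (blinfun_apply (U n m) x) \<le> c * c / real (Suc (n - m)) * norm x" for x
    proof -
      define e where "e = (\<lambda>k. if k = m then x else 0)"
      have e: "e \<in> X" "N e \<le> norm x"
        using single[of m x] m unfolding e_def by auto
      have conv_e: "convolution U e k = (if m \<le> k then U k m x else 0)" for k
      proof -
        have "convolution U e k = (\<Sum>j=0..k. if j = m then U k m x else 0)"
          unfolding convolution_def e_def by (intro sum.cong) (auto simp: blinfun.zero_right)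
        then show ?thesis
          by (auto simp: sum.delta)
      qed
      define f where "f = ?t n e"
      have f: "f \<in> X" "N f \<le> c * norm x"
      proof -
        show "f \<in> X"
          unfolding f_def using finite_support[of "convolution U e" n] at_0[OF invariant[OF e(1)]] by simp
        show "N f \<le> c * norm x"
          unfolding f_def using c[OF e(1), of n] mult_left_mono[OF e(2) c_nonneg] by linarith
      qed
      have "convolution U f n = (\<Sum>j=0..n. if m \<le> j then U n m x else 0)"
        unfolding convolution_def
      proof (rule sum.cong[OF refl])
        fix j assume "j \<in> {0..n}"
        then show "U n j (f j) = (if m \<le> j then U n m x else 0)"
          using comp[of m j n] by (auto simp: f_def conv_e blinfun.zero_right)
      qed
      also have "\<dots> = (\<Sum>j=m..n. U n m x)"
        by (rule sum.mono_neutral_cong_right) auto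
      finally have "norm (convolution U f n) = real (Suc (n - m)) * norm (U n m x)"
        using m by (simp add: sum_constant_scaleR Suc_diff_le)
      moreover have "norm (convolution U f n) \<le> N (?t n f)"
        using norm_le[of "?t n f" n] finite_support[of "convolution U f" n]
          at_0[OF invariant[OF f(1)]] by simp
      moreover have "N (?t n f) \<le> c * (c * norm x)"
        using c[OF f(1), of n] mult_left_mono[OF f(2) c_nonneg] by linarith
      ultimately show ?thesis
        by (simp add: field_simps)
    qed
    then have "norm (U n m) \<le> c * c / real (Suc (n - m))"
      by (intro norm_blinfun_bound) (auto simp: c_nonneg)
    then show ?thesis
      by (simp add: field_simps)
  qed
  then show ?thesis
    using c_nonneg by (intro exI[of _ "c * c"]) auto
qed

end

lemma evolution_family_exponential_decay:
  fixes U :: "nat \<Rightarrow> nat \<Rightarrow> 'a::real_normed_vector \<Rightarrow>\<^sub>L 'a"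
  assumes id: "\<And>m. U m m = id_blinfun"
    and comp: "\<And>m p n. n \<le> p \<Longrightarrow> p \<le> m \<Longrightarrow> U m n = U m p o\<^sub>L U p n"
    and decay: "K \<ge> 0" "\<And>n m. 1 \<le> m \<Longrightarrow> m \<le> n \<Longrightarrow> real (Suc (n - m)) * norm (U n m) \<le> K"
  shows "\<exists>M q. 0 \<le> M \<and> 0 < q \<and> q < 1 \<and> (\<forall>n m. m \<le> n \<longrightarrow> norm (U n m) \<le> M * q ^ (n - m))"
proof -
  \<comment> \<open>With \<open>2 * K <= L\<close> the linear decay gives norm at most 1/2 after
    \<open>L\<close> steps.\<close>
  obtain L :: nat where L: "2 * K \<le> real L" "0 < L"
    using reals_Archimedean2[of "2 * K"] decay(1)
    by (metis less_imp_le of_nat_0_less_iff order_le_less_trans mult_nonneg_nonneg zero_le_numeral)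
  \<comment> \<open>The L-th root of 1/2, so that a block of \<open>L\<close> steps contributes the
    factor \<open>q ^ L\<close>.\<close>
  define q :: real where "q = (1 / 2) powr (1 / real L)"
  have q: "0 < q" "q < 1"
    using L powr_less_mono2[of "1 / real L" "1 / 2" 1] by (auto simp: q_def)
  have q_L: "q ^ L = 1 / 2"
    using L by (simp add: q_def powr_power)
  have bound: "norm (U n m) \<le> K" if "1 \<le> m" "m \<le> n" for n m
  proof -
    have "1 * norm (U n m) \<le> real (Suc (n - m)) * norm (U n m)"
      by (intro mult_right_mono) auto
    then show ?thesis
      using decay(2)[OF that] by simp
  qed
  have half: "norm (U (m + L) m) \<le> 1 / 2" if "1 \<le> m" for m
  proof -
    have "real L * norm (U (m + L) m) \<le> real (Suc L) * norm (U (m + L) m)"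
      by (intro mult_right_mono) auto
    also have "\<dots> \<le> K"
      using decay(2)[OF that, of "m + L"] by simp
    also have "\<dots> \<le> real L * (1 / 2)"
      using L by simp
    finally show ?thesis
      using L by (simp only: mult_le_cancel_left_pos of_nat_0_less_iff)
  qed
  \<comment> \<open>Induction on \<open>n - m\<close>, peeling off the first block of
    \<open>L\<close> steps. The factor 2 covers a remainder shorter than \<open>L\<close>, where
    \<open>q ^ (n - m)\<close> is at least 1/2.\<close>
  have pos: "norm (U n m) \<le> 2 * K * q ^ (n - m)" if "1 \<le> m" "m \<le> n" for n m
    using that
  proof (induction "n - m" arbitrary: m rule: less_induct)
    case less
    show ?case
    proof (cases "n - m < L")
      case True
      then have "q ^ L \<le> q ^ (n - m)"
        using q by (intro power_decreasing) auto
      then have "K * 1 \<le> K * (2 * q ^ (n - m))"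
        using q_L decay(1) by (intro mult_left_mono) auto
      then show ?thesis
        using bound[OF less.prems] by simp
    next
      case False
      have "norm (U n m) \<le> norm (U n (m + L)) * norm (U (m + L) m)"
        using comp[of m "m + L" n] False less.prems by (simp add: norm_blinfun_compose)
      also have "\<dots> \<le> (2 * K * q ^ (n - (m + L))) * q ^ L"
        using less.hyps[of "m + L"] half[of m] False less.prems L q q_L decay(1)
        by (intro mult_mono) auto
      also have "\<dots> = 2 * K * q ^ (n - m)"
        using False less.prems by (simp add: mult.assoc flip: power_add)
      finally show ?thesis .
    qed
  qed
  \<comment> \<open>The summands serve \<open>n = m = 0\<close>, \<open>m >= 1\<close>, and the
    passage through \<open>U 1 0\<close>. The last is divided by \<open>q\<close> because the path
    from 1 to \<open>n\<close> is one step shorter than that from 0.\<close>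
  define M where "M = 1 + 2 * K + 2 * K / q * norm (U 1 0)"
  have M: "0 \<le> M" "2 * K \<le> M" "1 \<le> M" "2 * K / q * norm (U 1 0) \<le> M"
    using q decay(1) by (auto simp: M_def)
  have "norm (U n m) \<le> M * q ^ (n - m)" if mn: "m \<le> n" for n m
  proof -
    consider "1 \<le> m" | "m = 0" "n = 0" | "m = 0" "1 \<le> n"
      by fastforce
    then show ?thesis
    proof cases
      case 1
      have "norm (U n m) \<le> 2 * K * q ^ (n - m)"
        by (rule pos[OF 1 mn])
      also have "\<dots> \<le> M * q ^ (n - m)"
        using M(2) q by (intro mult_right_mono) auto
      finally show ?thesis .
    next
      case 2
      have "norm (U 0 0) \<le> 1"
        unfolding id by (rule norm_blinfun_id_le)
      then show ?thesis
        using 2 M by simp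
    next
      case 3
      then obtain n' where n': "n = Suc n'"
        by (cases n) auto
      have "norm (U n 0) \<le> norm (U n 1) * norm (U 1 0)"
        using comp[of 0 1 n] 3 by (simp add: norm_blinfun_compose)
      also have "\<dots> \<le> (2 * K * q ^ (n - 1)) * norm (U 1 0)"
        using pos[of 1 n] 3 by (intro mult_right_mono) auto
      also have "\<dots> = (2 * K / q * norm (U 1 0)) * q ^ n"
        using q by (simp add: n')
      also have "\<dots> \<le> M * q ^ n"
        using M q by (intro mult_right_mono) auto
      finally show ?thesis
        using 3 by simp
    qed
  qed
  then show ?thesis
    using M q by blast
qed

text \<open>Exponents and ratios correspond by \<open>q = exp \<omega>\<close>. A negative infimum
  means that some exponent is negative, so it does not matter whether the infimum is
  attained.\<close>

lemma growth_bound_negative_iff: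
  fixes U :: "nat \<Rightarrow> nat \<Rightarrow> 'a::real_normed_vector \<Rightarrow>\<^sub>L 'a"
  shows "growth_bound U < 0 \<longleftrightarrow>
    (\<exists>M q. 0 \<le> M \<and> 0 < q \<and> q < 1 \<and> (\<forall>n m. m \<le> n \<longrightarrow> norm (U n m) \<le> M * q ^ (n - m)))"
proof
  assume "growth_bound U < 0"
  then obtain \<omega> where \<omega>: "\<omega> \<in> growth_exponents U" "\<omega> < 0"
    by (auto simp: growth_bound_def INF_less_iff)
  then obtain B where B: "\<And>n m. m \<le> n \<Longrightarrow> exp (- \<omega> * (real n - real m)) * norm (U n m) \<le> B"
    unfolding growth_exponents_def bdd_above_def by blast
  have "norm (U n m) \<le> B * exp \<omega> ^ (n - m)" if "m \<le> n" for n m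
  proof -
    have "norm (U n m) = exp (\<omega> * (real n - real m)) * (exp (- \<omega> * (real n - real m)) * norm (U n m))"
      by (simp flip: mult.assoc exp_add)
    also have "\<dots> \<le> exp (\<omega> * (real n - real m)) * B"
      using B[OF that] by (intro mult_left_mono) auto
    also have "exp (\<omega> * (real n - real m)) = exp \<omega> ^ (n - m)"
      using that by (simp add: of_nat_diff mult.commute flip: exp_of_nat_mult)
    finally show ?thesis
      by (simp add: mult.commute)
  qed
  moreover have "0 \<le> B"
    using order_trans[OF _ B[of 0 0]] by simp
  ultimately show "\<exists>M q. 0 \<le> M \<and> 0 < q \<and> q < 1 \<and> (\<forall>n m. m \<le> n \<longrightarrow> norm (U n m) \<le> M * q ^ (n - m))"
    using \<omega>(2) by (intro exI[of _ B] exI[of _ "exp \<omega>"]) auto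
next
  assume "\<exists>M q. 0 \<le> M \<and> 0 < q \<and> q < 1 \<and> (\<forall>n m. m \<le> n \<longrightarrow> norm (U n m) \<le> M * q ^ (n - m))"
  then obtain M q where q: "0 < q" "q < 1"
    and U: "\<And>n m. m \<le> n \<Longrightarrow> norm (U n m) \<le> M * q ^ (n - m)"
    by blast
  have "exp (- ln q * (real n - real m)) * norm (U n m) \<le> M" if "m \<le> n" for n m
  proof -
    have "exp (- ln q * (real n - real m)) = 1 / q ^ (n - m)"
      using that q
      by (simp add: exp_minus inverse_eq_divide mult.commute[of "ln q"] exp_of_nat_mult flip: of_nat_diff)
    then have "exp (- ln q * (real n - real m)) * norm (U n m) = norm (U n m) / q ^ (n - m)"
      by (simp only: times_divide_eq_left mult_1)
    also have "\<dots> \<le> M"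
      using U[OF that] q by (simp add: divide_le_eq)
    finally show ?thesis .
  qed
  then have "ln q \<in> growth_exponents U"
    unfolding growth_exponents_def bdd_above_def by blast
  then show "growth_bound U < 0"
    unfolding growth_bound_def INF_less_iff using q by (intro bexI[of _ "ln q"]) auto
qed

section \<open>Resolvent of the evolution semigroup\<close>

lemma additive_scaleC: "Modules.additive ((*\<^sub>C) a :: 'a::complex_normed_vector \<Rightarrow> 'a)"
  by (simp add: Modules.additive_def scaleC_add_right)

lemmas scaleC_sum_right = Modules.additive.sum[OF additive_scaleC]

text \<open>The Neumann series of the resolvent at \<open>z\<close>, summed along the trajectories.\<close>

definition resolvent_kernel ::
  "(nat \<Rightarrow> nat \<Rightarrow> 'a::complex_normed_vector \<Rightarrow>\<^sub>L 'a) \<Rightarrow> complex \<Rightarrow> (nat \<Rightarrow> 'a) \<Rightarrow> nat \<Rightarrow> 'a" where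
  "resolvent_kernel U z f = (\<lambda>n. \<Sum>j\<le>n. inverse z ^ Suc (n - j) *\<^sub>C U n j (f j))"

lemma resolvent_kernel_0:
  "evolution_family U \<Longrightarrow> resolvent_kernel U z f 0 = inverse z *\<^sub>C f 0"
  by (simp add: resolvent_kernel_def evolution_family_def)

text \<open>This recursion reduces both resolvent identities to single coordinates. Complex
  homogeneity of \<open>U\<close> is what carries the powers of \<open>inverse z\<close> through
  it.\<close>

lemma resolvent_kernel_Suc:
  assumes "evolution_family U"
  shows "resolvent_kernel U z f (Suc n)
    = inverse z *\<^sub>C (f (Suc n) + U (Suc n) n (resolvent_kernel U z f n))"
proof -
  have id: "U (Suc n) (Suc n) = id_blinfun"
    and comp: "j \<le> n \<Longrightarrow> U (Suc n) j = U (Suc n) n o\<^sub>L U n j"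
    and hom: "U (Suc n) n (a *\<^sub>C x) = a *\<^sub>C U (Suc n) n x" for j a x
    using assms by (auto simp: evolution_family_def)
  have "inverse z ^ Suc (Suc n - j) *\<^sub>C U (Suc n) j (f j)
      = inverse z *\<^sub>C U (Suc n) n (inverse z ^ Suc (n - j) *\<^sub>C U n j (f j))" if "j \<le> n" for j
    using that by (simp add: comp[OF that] hom scaleC_scaleC Suc_diff_le)
  then show ?thesis
    by (simp add: resolvent_kernel_def id scaleC_add_right blinfun.sum_right scaleC_sum_right add.commute)
qed

lemma in_resolvent_set:
  fixes U :: "nat \<Rightarrow> nat \<Rightarrow> 'a::complex_banach \<Rightarrow>\<^sub>L 'a"
  assumes X: "banach_sequence_space X N" and U: "evolution_family U"
    and decay: "0 \<le> M" "0 < q" "\<And>n m. m \<le> n \<Longrightarrow> norm (U n m) \<le> M * q ^ (n - m)"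
    and z: "q < cmod z"
  shows "z \<in> resolvent_set X N (evolution_semigroup U 1)"
proof -
  let ?S = "resolvent_kernel U z" and ?T = "evolution_semigroup U 1"
  have z0: "z \<noteq> 0"
    using z decay(2) by auto
  have hom: "m \<le> n \<Longrightarrow> U n m (a *\<^sub>C x) = a *\<^sub>C U n m x" for n m a x
    using U by (auto simp: evolution_family_def)
  \<comment> \<open>One factor \<open>inverse z\<close> goes into the constant; the remaining powers
    turn the ratio into \<open>q / cmod z\<close>, which is below 1.\<close>
  have S_bounded: "?S f \<in> X \<and> N (?S f) \<le> (M / cmod z) / (1 - q / cmod z) * N f" if "f \<in> X" for f
    unfolding resolvent_kernel_def
  proof (rule banach_sequence_space.exponential_kernel[OF X that])
    fix n j :: nat
    assume j: "j \<le> n"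
    have "norm (inverse z ^ Suc (n - j) *\<^sub>C U n j (f j))
        \<le> inverse (cmod z) ^ Suc (n - j) * (M * q ^ (n - j) * norm (f j))"
      unfolding norm_scaleC norm_power norm_inverse
      by (intro mult_left_mono order_trans[OF norm_blinfun] mult_right_mono decay j) auto
    then show "norm (inverse z ^ Suc (n - j) *\<^sub>C U n j (f j))
        \<le> M / cmod z * (q / cmod z) ^ (n - j) * norm (f j)"
      by (simp add: divide_inverse power_mult_distrib mult_ac)
  qed (use decay z in \<open>auto simp: divide_less_eq\<close>)
  have "bounded_operator_on X N ?S"
    unfolding bounded_operator_on_def
  proof (intro conjI ballI allI)
    fix f g :: "nat \<Rightarrow> 'a" and a
    show "?S (\<lambda>n. f n + g n) = (\<lambda>n. ?S f n + ?S g n)"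
      by (simp add: resolvent_kernel_def blinfun.add_right scaleC_add_right sum.distrib)
    show "?S (\<lambda>n. a *\<^sub>C f n) = (\<lambda>n. a *\<^sub>C ?S f n)"
      by (simp add: resolvent_kernel_def hom scaleC_scaleC scaleC_sum_right mult.commute)
  qed (use S_bounded in blast)+
  \<comment> \<open>The two inverse identities are purely algebraic and hold for every sequence, by
    the recursion alone.\<close>
  moreover have "?S (\<lambda>n. z *\<^sub>C f n - ?T f n) = f" for f
  proof
    show "?S (\<lambda>n. z *\<^sub>C f n - ?T f n) n = f n" for n
      by (induction n)
        (simp_all add: resolvent_kernel_0[OF U] resolvent_kernel_Suc[OF U] evolution_semigroup_def
          z0 scaleC_scaleC scaleC_one)
  qed
  moreover have "(\<lambda>n. z *\<^sub>C ?S f n - ?T (?S f) n) = f" for f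
  proof
    show "z *\<^sub>C ?S f n - ?T (?S f) n = f n" for n
      by (cases n)
        (simp_all add: resolvent_kernel_0[OF U] resolvent_kernel_Suc[OF U] evolution_semigroup_def
          z0 scaleC_scaleC scaleC_one)
  qed
  ultimately show ?thesis
    unfolding resolvent_set_def by blast
qed

lemma convolution_Suc:
  assumes "evolution_family U"
  shows "convolution U f (Suc n) = f (Suc n) + U (Suc n) n (convolution U f n)"
proof -
  have id: "U (Suc n) (Suc n) = id_blinfun"
    and comp: "j \<le> n \<Longrightarrow> U (Suc n) j = U (Suc n) n o\<^sub>L U n j" for j
    using assms by (auto simp: evolution_family_def)
  have "(\<Sum>j=0..n. U (Suc n) j (f j)) = U (Suc n) n (\<Sum>j=0..n. U n j (f j))"
    unfolding blinfun.sum_right by (intro sum.cong refl, subst comp) auto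
  then show ?thesis
    by (simp add: convolution_def id)
qed

text \<open>The recursion \<open>g = f + T g\<close> identifies the convolution with the resolvent at 1.\<close>

lemma convolution_in_space:
  assumes U: "evolution_family U"
    and one: "1 \<in> resolvent_set X N (evolution_semigroup U 1)" and f: "f \<in> X"
  shows "convolution U f \<in> X"
proof -
  obtain S where S: "bounded_operator_on X N S"
    "(\<lambda>n. 1 *\<^sub>C S f n - evolution_semigroup U 1 (S f) n) = f"
    using one f unfolding resolvent_set_def by blast
  have rec: "S f n = f n + evolution_semigroup U 1 (S f) n" for n
    using fun_cong[OF S(2), of n] by (simp add: scaleC_one algebra_simps)
  have "S f n = convolution U f n" for n
  proof (induction n)
    case 0
    have "U 0 0 = id_blinfun"
      using U by (simp add: evolution_family_def)
    then show ?case
      using rec[of 0] by (simp add: evolution_semigroup_def convolution_def)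
  next
    case (Suc n)
    then show ?case
      using rec[of "Suc n"] by (simp add: evolution_semigroup_def convolution_Suc[OF U])
  qed
  then have "S f = convolution U f" ..
  then show ?thesis
    using S(1) f by (auto simp: bounded_operator_on_def)
qed

section \<open>Closing the cycle of implications between stability, spectrum and convolution\<close>

theorem theorem1p1:
  fixes U :: "nat \<Rightarrow> nat \<Rightarrow> 'a::complex_banach \<Rightarrow>\<^sub>L 'a"
    and X :: "(nat \<Rightarrow> 'a) set"
    and N :: "(nat \<Rightarrow> 'a) \<Rightarrow> real"
  assumes nontrivial: "\<exists>x::'a. x \<noteq> 0"
    and evol: "evolution_family U"
    and exp_bounded: "exponentially_bounded U"
    and space: "(X = c00 \<and> N = sup_norm) \<or> (X = linf0 \<and> N = sup_norm) \<or>
      (\<exists>p\<ge>1. X = lp0 p \<and> N = lp_norm p)"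
  shows "(growth_bound U < 0 \<longleftrightarrow> spectral_radius X N (evolution_semigroup U 1) < 1)
    \<and> (spectral_radius X N (evolution_semigroup U 1) < 1 \<longleftrightarrow> (\<forall>f\<in>X. convolution U f \<in> X))
    \<and> ((\<forall>f\<in>X. convolution U f \<in> X) \<longleftrightarrow>
        (convolution_domain U X = X \<and> (\<exists>c. \<forall>f\<in>X. N (convolution U f) \<le> c * N f)))"
proof -
  let ?r = "spectral_radius X N (evolution_semigroup U 1)"
  let ?decay = "\<lambda>M q. 0 \<le> M \<and> 0 < q \<and> q < 1 \<and> (\<forall>n m. m \<le> n \<longrightarrow> norm (U n m) \<le> M * q ^ (n - m))"
  have X: "banach_sequence_space X N"
    using space by (elim disjE exE conjE)
      (simp_all add: c00.banach_sequence_space_axioms linf0.banach_sequence_space_axioms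
        banach_sequence_space_lp0)
  have stable_iff: "growth_bound U < 0 \<longleftrightarrow> (\<exists>M q. ?decay M q)"
    by (rule growth_bound_negative_iff)
  have stable_imp_spectral: "?r < 1" if "growth_bound U < 0"
  proof -
    from that[unfolded stable_iff] obtain M q where decay: "?decay M q"
      by (elim exE)
    have "z \<in> resolvent_set X N (evolution_semigroup U 1)" if "q < cmod z" for z
      using in_resolvent_set[OF X evol _ _ _ that, of M] decay by blast
    \<comment> \<open>The spectrum lies in the closed disc of radius \<open>q\<close>, which keeps
      the supremum strictly below 1.\<close>
    then have "?r \<le> ereal q"
      unfolding spectral_radius_def spectrum_def by (intro SUP_least) (force simp: not_less)
    also have "\<dots> < 1"
      using decay by simp
    finally show ?thesis .
  qed
  have spectral_imp_invariant: "\<forall>f\<in>X. convolution U f \<in> X" if "?r < 1"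
  proof -
    have "1 \<notin> spectrum X N (evolution_semigroup U 1)"
    proof
      assume "1 \<in> spectrum X N (evolution_semigroup U 1)"
      then have "ereal (cmod 1) \<le> ?r"
        unfolding spectral_radius_def by (rule SUP_upper)
      then show False
        using that by (simp add: one_ereal_def)
    qed
    then show ?thesis
      using convolution_in_space[OF evol] by (simp add: spectrum_def)
  qed
  have invariant_imp_stable: "growth_bound U < 0" if "\<forall>f\<in>X. convolution U f \<in> X"
  proof -
    have id: "U m m = id_blinfun" and comp: "n \<le> p \<Longrightarrow> p \<le> m \<Longrightarrow> U m n = U m p o\<^sub>L U p n" for m n p
      using evol by (auto simp: evolution_family_def)
    have "\<exists>K\<ge>0. \<forall>n m. 1 \<le> m \<longrightarrow> m \<le> n \<longrightarrow> real (Suc (n - m)) * norm (U n m) \<le> K"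
      using that by (intro banach_sequence_space.evolution_family_linear_decay[OF X comp]) simp_all
    then obtain K where K: "0 \<le> K"
      "\<forall>n m. 1 \<le> m \<longrightarrow> m \<le> n \<longrightarrow> real (Suc (n - m)) * norm (U n m) \<le> K"
      by (elim exE conjE)
    show ?thesis
      unfolding stable_iff
      by (rule evolution_family_exponential_decay[OF id comp K(1)]) (use K(2) in simp_all)
  qed
  \<comment> \<open>The norm bound in the fourth statement is reached from invariance by way of
    exponential decay, which gives the explicit constant \<open>M / (1 - q)\<close>.\<close>
  have stable_imp_bounded: "\<exists>c. \<forall>f\<in>X. N (convolution U f) \<le> c * N f" if "growth_bound U < 0"
  proof -
    from that[unfolded stable_iff] obtain M q where decay: "?decay M q"
      by (elim exE)
    have "N (convolution U f) \<le> M / (1 - q) * N f" if "f \<in> X" for f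
      unfolding convolution_def atLeast0AtMost
    proof (rule banach_sequence_space.exponential_kernel[OF X that, THEN conjunct2])
      fix k j :: nat
      assume "j \<le> k"
      then show "norm (U k j (f j)) \<le> M * q ^ (k - j) * norm (f j)"
        using decay by (intro order_trans[OF norm_blinfun] mult_right_mono) auto
    qed (use decay in auto)
    then show ?thesis
      by blast
  qed
  have "convolution_domain U X = X \<longleftrightarrow> (\<forall>f\<in>X. convolution U f \<in> X)"
    by (auto simp: convolution_domain_def)
  then show ?thesis
    using stable_imp_spectral spectral_imp_invariant invariant_imp_stable stable_imp_bounded
    by blast
qed

end
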